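(* For every constant $p\in(0,1)$, the probability that the random graph $G(n,p)$ has a vertex-labeling by product from $\mathbb{N}_{11}=\{1,\ldots,11\}$ tends to $1$ as $n\to\infty$.
   Context: $G(n,p)$ is the Erdős–Rényi random graph on $n$ vertices in which each pair of vertices is joined independently with probability $p$. A vertex-labeling by product from $\mathbb{N}_k=\{1,\ldots,k\}$ of a graph $G$ is a map $f:V(G)\to\mathbb{N}_k$ such that $c(v)=\prod_{u\sim v} f(u)$ (product over the neighbors of $v$) satisfies $c(u)\neq c(v)$ for every edge $uv$. *)

theory Defs
  imports "HOL-Probability.Probability"
begin

text \<open>A graph is given by a vertex set \<open>V\<close> and a set \<open>E\<close> of two-element subsets of \<open>V\<close>.\<close>

definition vertex_pairs :: "'a set \<Rightarrow> 'a set set" where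
  "vertex_pairs V = {e. e \<subseteq> V \<and> card e = 2}"

definition neighbours :: "'a set \<Rightarrow> 'a set set \<Rightarrow> 'a \<Rightarrow> 'a set" where
  "neighbours V E v = {u \<in> V. {u, v} \<in> E}"

definition neighbour_product :: "'a set \<Rightarrow> 'a set set \<Rightarrow> ('a \<Rightarrow> nat) \<Rightarrow> 'a \<Rightarrow> nat" where
  "neighbour_product V E f v = (\<Prod>u\<in>neighbours V E v. f u)"

definition product_labeling :: "nat \<Rightarrow> 'a set \<Rightarrow> 'a set set \<Rightarrow> ('a \<Rightarrow> nat) \<Rightarrow> bool" where
  "product_labeling k V E f \<longleftrightarrow>
     (\<forall>v\<in>V. f v \<in> {1..k}) \<and>
     (\<forall>u\<in>V. \<forall>v\<in>V. {u, v} \<in> E \<longrightarrow> neighbour_product V E f u \<noteq> neighbour_product V E f v)"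

text \<open>The vertex set of \<open>G(n,p)\<close> is \<open>{..<n}\<close>; the value of the random variable is the edge set.\<close>

definition random_graph :: "nat \<Rightarrow> real \<Rightarrow> nat set set pmf" where
  "random_graph n p =
     map_pmf (\<lambda>b. {e \<in> vertex_pairs {..<n}. b e})
       (Pi_pmf (vertex_pairs {..<n}) False (\<lambda>_. bernoulli_pmf p))"

end

theory Submission
  imports Defs "HOL-Real_Asymp.Real_Asymp"
begin

text \<open>
  Label the vertices with the primes 2, 3, 5, 7, 11 according to their residue modulo 5. By unique
  factorisation, \<open>c(u) = c(v)\<close> forces \<open>u\<close> and \<open>v\<close> to have equally many neighbours in each of the
  five residue classes. Conditionally on all edges not at \<open>u\<close> and on the edge \<open>uv\<close> being present,
  this prescribes the values of five independent binomial variables with about \<open>n/5\<close> trials each.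
  A binomial variable with \<open>m\<close> trials takes any given value with probability \<open>O(m\<^sup>-\<^sup>1\<^sup>/\<^sup>2)\<close>, so a given
  pair is bad with probability \<open>O(n\<^sup>-\<^sup>5\<^sup>/\<^sup>2)\<close>, and the union bound over the at most \<open>n\<^sup>2\<close> pairs gives
  \<open>O(n\<^sup>-\<^sup>1\<^sup>/\<^sup>2)\<close>.
\<close>

section \<open>Point probabilities of the binomial distribution\<close>

text \<open>At \<open>K = k + j\<close> the ratio of consecutive probabilities is
  \<open>(m - K) * p / ((K + 1) * (1 - p))\<close>. Since \<open>K\<close> exceeds the mean by at
  most \<open>j\<close>, this is at least 1 minus \<open>j + 1\<close> over the variance.\<close>

lemma pmf_binomial_step:
  assumes "0 < p" "p < 1" "0 < m" "real k \<le> real m * p"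
    and "real (j + 1) \<le> real m * (p * (1 - p))"
  shows "pmf (binomial_pmf m p) (k + j) * (1 - real (j + 1) / (real m * (p * (1 - p))))
           \<le> pmf (binomial_pmf m p) (k + j + 1)"
proof -
  \<comment> \<open>The variance is at most \<open>m * (1 - p)\<close>, hence
    \<open>k + j + 1 \<le> m * p + m * (1 - p) = m\<close>, and the subtraction \<open>m - K\<close>
    below is not truncated.\<close>
  have "real m * (p * (1 - p)) \<le> real m * (1 - p)"
    using assms by (intro mult_left_mono) (auto simp: mult_left_le_one_le)
  then have "real (k + j + 1) \<le> real m"
    using assms(4,5) by (simp add: algebra_simps)
  then have kj: "k + j < m" by simp
  define K r where "K = k + j" and "r = real m * (p * (1 - p))"
  let ?b = "pmf (binomial_pmf m p)"
  have r: "r > 0" using assms by (simp add: r_def)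
  have K: "K < m" "real K \<le> real m * p + real j" using kj assms(4) by (auto simp: K_def)
  have choose: "real (m choose Suc K) * real (Suc K) = real (m choose K) * real (m - K)"
    by (metis binomial_absorb_comp binomial_absorption mult.commute of_nat_mult)
  have ratio: "?b (K + 1) * (real (K + 1) * (1 - p)) = ?b K * (real (m - K) * p)"
  proof -
    have "(1 - p) ^ (m - K) = (1 - p) * (1 - p) ^ (m - Suc K)"
      using K(1) by (metis Suc_diff_Suc power_Suc)
    then show ?thesis
      using choose assms(1,2) by (simp add: pmf_binomial mult_ac)
  qed
  \<comment> \<open>The ratio bound with its denominator cleared; both sides are compared with
    \<open>r - j * p\<close>.\<close>
  have "(1 - real (j + 1) / r) * (real (K + 1) * (1 - p)) \<le> (1 - real (j + 1) / r) * (r + real (j + 1) * (1 - p))"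
  proof (rule mult_left_mono)
    have "real (K + 1) * (1 - p) \<le> (real m * p + real (j + 1)) * (1 - p)"
      using K(2) assms by (intro mult_right_mono) auto
    then show "real (K + 1) * (1 - p) \<le> r + real (j + 1) * (1 - p)"
      by (simp add: r_def algebra_simps)
    show "0 \<le> 1 - real (j + 1) / r" using assms(5) r by (simp add: r_def)
  qed
  also have "\<dots> = r - real (j + 1) * p - (real (j + 1))\<^sup>2 * (1 - p) / r"
    using r by (simp add: field_simps power2_eq_square)
  also have "\<dots> \<le> r - real j * p" 
  proof -
    have "0 \<le> (real (j + 1))\<^sup>2 * (1 - p) / r" using r assms by simp
    moreover have "real j * p \<le> real (j + 1) * p" using assms by (intro mult_right_mono) auto
    ultimately show ?thesis by linarith
  qed
  also have "\<dots> \<le> real (m - K) * p"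
  proof -
    have "(real m * (1 - p) - real j) * p \<le> real (m - K) * p"
      using K assms by (intro mult_right_mono) (auto simp: algebra_simps)
    then show ?thesis by (simp add: r_def algebra_simps)
  qed
  finally have "?b K * ((1 - real (j + 1) / r) * (real (K + 1) * (1 - p))) \<le> ?b K * (real (m - K) * p)"
    by (rule mult_left_mono) simp
  then have "(?b K * (1 - real (j + 1) / r)) * (real (K + 1) * (1 - p)) \<le> ?b (K + 1) * (real (K + 1) * (1 - p))"
    using ratio by (simp add: mult_ac)
  then have "?b K * (1 - real (j + 1) / r) \<le> ?b (K + 1)"
    by (rule mult_right_le_imp_le) (use assms in simp)
  then show ?thesis by (simp add: K_def r_def)
qed

text \<open>
  Starting from \<open>k\<close> below the mean, the probabilities lose at most a factor \<open>2\<close> over a window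
  of order \<open>sqrt (m p (1 - p))\<close> to the right of \<open>k\<close>, and they sum to at most \<open>1\<close>.
\<close>

lemma pmf_binomial_le_of_le_mean:
  assumes p: "0 < p" "p < 1" and m: "0 < m" and k: "real k \<le> real m * p"
  shows "pmf (binomial_pmf m p) k \<le> 4 / sqrt (real m * (p * (1 - p)))"
proof -
  define r where "r = real m * (p * (1 - p))"
  \<comment> \<open>Over this window, \<open>s\<close> steps that each lose at most the fraction
    \<open>s / r\<close> lose at most \<open>s^2 / r \<le> 1/2\<close> in total.\<close>
  define s where "s = nat \<lfloor>sqrt (r / 2)\<rfloor>"
  let ?b = "pmf (binomial_pmf m p)"
  have r: "r > 0" using assms by (simp add: r_def)
  have s: "real s \<le> sqrt (r / 2)" "sqrt (r / 2) \<le> real (s + 1)"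
  proof -
    have "real s = of_int \<lfloor>sqrt (r / 2)\<rfloor>" using r by (simp add: s_def)
    then show "real s \<le> sqrt (r / 2)" "sqrt (r / 2) \<le> real (s + 1)" by linarith+
  qed
  have s2: "(real s)\<^sup>2 \<le> r / 2"
    using s(1) r by (metis of_nat_0_le_iff power_mono real_sqrt_pow2 half_gt_zero less_imp_le)
  have half: "real j * (real s / r) \<le> 1 / 2" if "j \<le> s" for j
  proof -
    have "real j * real s \<le> real s * real s" using that by (intro mult_right_mono) auto
    then show ?thesis using s2 r by (simp add: field_simps power2_eq_square)
  qed
  have decay: "?b k * (1 - real j * (real s / r)) \<le> ?b (k + j)" if "j \<le> s" for j
    using that
  proof (induction j)
    case 0
    then show ?case by simp
  next
    case (Suc j)
    have le: "real (j + 1) / r \<le> real s / r" using Suc.prems r by (intro divide_right_mono) auto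
    have "1 \<le> s" using Suc.prems by simp
    then have "real s / r \<le> 1 / 2" using half[of 1] by simp
    moreover from this have "real s \<le> r" using r by (simp add: field_simps)
    ultimately have d: "real s / r \<le> 1" "real (j + 1) \<le> r" using Suc.prems by auto
    \<comment> \<open>Bernoulli's inequality in one step: with \<open>x = s / r\<close>,
      \<open>1 - (j + 1) * x \<le> (1 - j * x) * (1 - x)\<close>.\<close>
    have "?b k * (1 - real (Suc j) * (real s / r))
        \<le> ?b k * ((1 - real j * (real s / r)) * (1 - real s / r))"
      using r by (intro mult_left_mono) (auto simp: field_simps)
    also have "\<dots> \<le> ?b (k + j) * (1 - real s / r)"
      using Suc d by (simp add: mult.assoc [symmetric] mult_right_mono)
    also have "\<dots> \<le> ?b (k + j) * (1 - real (j + 1) / r)"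
      using le by (intro mult_left_mono) auto
    also have "\<dots> \<le> ?b (k + Suc j)"
      using pmf_binomial_step[OF p m k, of j] d by (simp add: r_def)
    finally show ?case .
  qed
  have "real (s + 1) * (?b k / 2) = (\<Sum>j\<le>s. ?b k * (1 / 2))" by simp
  also have "\<dots> \<le> (\<Sum>j\<le>s. ?b (k + j))"
  proof (rule sum_mono)
    fix j assume j: "j \<in> {..s}"
    then have "?b k * (1 / 2) \<le> ?b k * (1 - real j * (real s / r))"
      using half[of j] by (intro mult_left_mono) auto
    also have "\<dots> \<le> ?b (k + j)" using decay[of j] j by simp
    finally show "?b k * (1 / 2) \<le> ?b (k + j)" .
  qed
  also have "\<dots> = sum ?b ((+) k ` {..s})" by (simp add: sum.reindex)
  also have "\<dots> = measure_pmf.prob (binomial_pmf m p) ((+) k ` {..s})"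
    by (simp add: measure_measure_pmf_finite)
  also have "\<dots> \<le> 1" by simp
  finally have "real (s + 1) * ?b k \<le> 2" by simp
  moreover have "sqrt (r / 2) * ?b k \<le> real (s + 1) * ?b k"
    using s(2) by (intro mult_right_mono) auto
  moreover have "sqrt r / 2 * ?b k \<le> sqrt (r / 2) * ?b k"
  proof (rule mult_right_mono)
    show "sqrt r / 2 \<le> sqrt (r / 2)" using r
      by (intro real_le_rsqrt) (auto simp: power_divide)
  qed simp
  ultimately have "sqrt r / 2 * ?b k \<le> 2" by linarith
  then have "?b k * sqrt r \<le> 4" by (simp add: mult.commute)
  then show ?thesis using r by (simp add: r_def[symmetric] pos_le_divide_eq)
qed

text \<open>Above the mean, counting failures instead of successes exchanges \<open>p\<close> and
  \<open>1 - p\<close> and moves the value below the mean; the bound is symmetric under this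
  exchange.\<close>

lemma pmf_binomial_le:
  assumes p: "0 < p" "p < 1" and m: "0 < m"
  shows "pmf (binomial_pmf m p) k \<le> 4 / sqrt (real m * (p * (1 - p)))"
proof (cases "real k \<le> real m * p \<or> k > m")
  case True
  then show ?thesis
  proof
    assume "k > m"
    then show ?thesis using p by (simp add: binomial_eq_0)
  qed (rule pmf_binomial_le_of_le_mean[OF assms])
next
  case False
  then have k: "k \<le> m" "real (m - k) \<le> real m * (1 - p)" by (auto simp: algebra_simps)
  have "pmf (binomial_pmf m p) k = pmf (binomial_pmf m (1 - p)) (m - k)"
    using k p by (simp add: pmf_binomial binomial_symmetric[of k m] mult_ac)
  also have "\<dots> \<le> 4 / sqrt (real m * ((1 - p) * (1 - (1 - p))))"
    by (rule pmf_binomial_le_of_le_mean) (use p m k in auto)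
  finally show ?thesis by (simp add: mult.commute)
qed

section \<open>Independent blocks of coordinates hitting prescribed counts\<close>

text \<open>Given the coordinates outside \<open>J\<close>, both \<open>P\<close> and the target
  \<open>k\<close> are fixed, while the count in \<open>J\<close> is still binomial and so hits the
  target with probability at most \<open>M\<close>. The factor for \<open>P\<close> lets the bound
  be iterated.\<close>

lemma prob_Pi_pmf_card_eq_le:
  fixes k :: "('a \<Rightarrow> bool) \<Rightarrow> nat"
  assumes I: "finite I" "J \<subseteq> I" and p: "0 \<le> p" "p \<le> 1"
    and P: "\<And>b b'. (\<And>e. e \<notin> J \<Longrightarrow> b e = b' e) \<Longrightarrow> P b \<longleftrightarrow> P b'"
    and k: "\<And>b b'. (\<And>e. e \<notin> J \<Longrightarrow> b e = b' e) \<Longrightarrow> k b = k b'"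
    and M: "\<And>c. pmf (binomial_pmf (card J) p) c \<le> M"
  shows "measure_pmf.prob (Pi_pmf I False (\<lambda>_. bernoulli_pmf p)) {b. P b \<and> card {e \<in> J. b e} = k b}
           \<le> M * measure_pmf.prob (Pi_pmf I False (\<lambda>_. bernoulli_pmf p)) {b. P b}"
proof -
  let ?Q = "\<lambda>A. Pi_pmf A False (\<lambda>_. bernoulli_pmf p)"
  define h :: "('a \<Rightarrow> bool) \<Rightarrow> ('a \<Rightarrow> bool) \<Rightarrow> 'a \<Rightarrow> bool"
    where "h = (\<lambda>g f x. if x \<in> J then f x else g x)"
  have J: "finite J" using I finite_subset by auto
  \<comment> \<open>The outside coordinates \<open>g\<close> are drawn first, so that the inner
    integral over \<open>f\<close> is the conditional probability given \<open>g\<close>.\<close>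
  have split: "?Q I = bind_pmf (?Q (I - J)) (\<lambda>g. map_pmf (h g) (?Q J))"
  proof -
    have "?Q I = ?Q (J \<union> (I - J))" using I by (simp add: Un_absorb1)
    also have "\<dots> = map_pmf (\<lambda>(f, g). h g f) (pair_pmf (?Q J) (?Q (I - J)))"
      using I J unfolding h_def by (subst Pi_pmf_union) auto
    also have "\<dots> = bind_pmf (?Q J) (\<lambda>f. bind_pmf (?Q (I - J)) (\<lambda>g. return_pmf (h g f)))"
      by (simp add: pair_pmf_def map_bind_pmf)
    also have "\<dots> = bind_pmf (?Q (I - J)) (\<lambda>g. bind_pmf (?Q J) (\<lambda>f. return_pmf (h g f)))"
      by (rule bind_commute_pmf)
    finally show ?thesis by (simp add: map_pmf_def)
  qed
  have M0: "0 \<le> M" by (rule order_trans[OF pmf_nonneg M])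
  have Ph: "P (h g f) \<longleftrightarrow> P g" for g f by (rule P) (simp add: h_def)
  have kh: "k (h g f) = k g" for g f by (rule k) (simp add: h_def)
  have cardh: "{e \<in> J. h g f e} = {e \<in> J. f e}" for g f by (auto simp: h_def)
  have fibre: "emeasure (?Q J) {f. card {e \<in> J. f e} = c} \<le> ennreal M" for c
  proof -
    have "pmf (binomial_pmf (card J) p) c = measure_pmf.prob (?Q J) {f. card {e \<in> J. f e} = c}"
      using J p by (subst binomial_pmf_altdef'[OF J refl, of _ False]) (auto simp: pmf_map vimage_def)
    with M[of c] show ?thesis by (simp add: measure_pmf.emeasure_eq_measure ennreal_leI)
  qed
  have "emeasure (?Q I) {b. P b \<and> card {e \<in> J. b e} = k b}
      = (\<integral>\<^sup>+g. emeasure (?Q J) {f. P g \<and> card {e \<in> J. f e} = k g} \<partial>?Q (I - J))"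
    unfolding split by (simp add: vimage_def Ph kh cardh)
  also have "\<dots> \<le> (\<integral>\<^sup>+g. ennreal M * indicator {g. P g} g \<partial>?Q (I - J))"
    by (rule nn_integral_mono) (auto simp: indicator_def fibre)
  also have "\<dots> = ennreal M * emeasure (?Q (I - J)) {g. P g}"
    by (simp add: nn_integral_cmult)
  also have "emeasure (?Q (I - J)) {g. P g} = emeasure (?Q I) {b. P b}"
  proof -
    have "emeasure (?Q J) {f. P g} = indicator {g. P g} g" for g
      by (simp add: indicator_def)
    then show ?thesis unfolding split by (simp add: vimage_def Ph)
  qed
  finally show ?thesis
    using M0 by (simp add: measure_pmf.emeasure_eq_measure flip: ennreal_mult)
qed

text \<open>Blocks are peeled off one at a time, the remaining conditions serving as
  \<open>P\<close>. They do not see the block \<open>J i\<close>: the other blocks are disjoint from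
  it, and every target ignores all blocks of \<open>L\<close>.\<close>

lemma prob_Pi_pmf_cards_eq_le:
  fixes k :: "'i \<Rightarrow> ('a \<Rightarrow> bool) \<Rightarrow> nat"
  assumes I: "finite I" and L: "finite L" and p: "0 \<le> p" "p \<le> 1"
    and J: "\<And>i. i \<in> L \<Longrightarrow> J i \<subseteq> I" and disj: "disjoint_family_on J L"
    and k: "\<And>i b b'. i \<in> L \<Longrightarrow> (\<And>e. e \<notin> (\<Union>j\<in>L. J j) \<Longrightarrow> b e = b' e) \<Longrightarrow> k i b = k i b'"
    and M: "\<And>i c. i \<in> L \<Longrightarrow> pmf (binomial_pmf (card (J i)) p) c \<le> M"
  shows "measure_pmf.prob (Pi_pmf I False (\<lambda>_. bernoulli_pmf p))
           {b. \<forall>i\<in>L. card {e \<in> J i. b e} = k i b} \<le> M ^ card L"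
proof -
  let ?P = "\<lambda>K. measure_pmf.prob (Pi_pmf I False (\<lambda>_. bernoulli_pmf p))
           {b. \<forall>i\<in>K. card {e \<in> J i. b e} = k i b}"
  have "?P K \<le> M ^ card K" if "finite K" "K \<subseteq> L" for K
    using that
  proof (induction rule: finite_induct)
    case empty
    then show ?case by simp
  next
    case (insert i K)
    have i: "i \<in> L" and KL: "K \<subseteq> L" using insert.prems by auto
    have M0: "0 \<le> M" by (rule order_trans[OF pmf_nonneg M[OF i]])
    have "?P (insert i K) = measure_pmf.prob (Pi_pmf I False (\<lambda>_. bernoulli_pmf p))
        {b. (\<forall>i\<in>K. card {e \<in> J i. b e} = k i b) \<and> card {e \<in> J i. b e} = k i b}"
      by (rule arg_cong[where f = "measure_pmf.prob _"]) auto
    also have "\<dots> \<le> M * ?P K"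
    proof (rule prob_Pi_pmf_card_eq_le[OF I J[OF i] p])
      fix b b' :: "'a \<Rightarrow> bool" assume eq: "\<And>e. e \<notin> J i \<Longrightarrow> b e = b' e"
      then have kk: "k j b = k j b'" if "j \<in> L" for j using that i by (intro k) auto
      then show "k i b = k i b'" using i by simp
      have "{e \<in> J j. b e} = {e \<in> J j. b' e}" if "j \<in> K" for j
      proof -
        have "J j \<inter> J i = {}"
          using disj that i KL insert.hyps by (intro disjoint_family_onD[OF disj]) auto
        then show ?thesis using eq by blast
      qed
      with kk KL show "(\<forall>i\<in>K. card {e \<in> J i. b e} = k i b) \<longleftrightarrow> (\<forall>i\<in>K. card {e \<in> J i. b' e} = k i b')"
        by (metis subsetD)
    qed (rule M[OF i])
    also have "\<dots> \<le> M * M ^ card K"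
      using insert KL M0 by (intro mult_left_mono) auto
    finally show ?case using insert.hyps by simp
  qed
  from this[OF L] show ?thesis by simp
qed

section \<open>Prime labels and residue classes modulo 5\<close>

definition prime_label :: "nat \<Rightarrow> nat" where
  "prime_label v = [2, 3, 5, 7, 11] ! (v mod 5)"

lemma prime_nth_first_primes: "i < 5 \<Longrightarrow> prime ([2, 3, 5, 7, 11 :: nat] ! i)"
proof -
  assume "i < 5"
  then have "[2, 3, 5, 7, 11 :: nat] ! i \<in> set [2, 3, 5, 7, 11]" by (intro nth_mem) simp
  moreover have "\<forall>q\<in>set [2, 3, 5, 7, 11 :: nat]. prime q" by simp
  ultimately show ?thesis by blast
qed

lemma prime_prime_label: "prime (prime_label v)"
  unfolding prime_label_def by (rule prime_nth_first_primes) simp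

lemma prime_label_in_range: "prime_label v \<in> {1..11}"
proof -
  have "prime_label v \<in> set [2, 3, 5, 7, 11]"
    unfolding prime_label_def by (rule nth_mem) simp
  then show ?thesis by auto
qed

lemma multiplicity_prime_label:
  assumes "i < 5"
  shows "multiplicity ([2, 3, 5, 7, 11] ! i) (prime_label v) = (if v mod 5 = i then 1 else 0)"
proof (cases "v mod 5 = i")
  case True
  then show ?thesis
    using prime_prime_label[of v] by (auto simp: prime_label_def intro!: multiplicity_self)
next
  case False
  have "distinct [2, 3, 5, 7, 11 :: nat]" by simp
  then have "[2, 3, 5, 7, 11] ! i \<noteq> prime_label v"
    unfolding prime_label_def using False assms by (subst nth_eq_iff_index_eq) auto
  then show ?thesis
    using False prime_nth_first_primes[OF assms] prime_prime_label[of v]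
    by (simp add: prime_multiplicity_other)
qed

text \<open>Each label is a single prime, so the exponent of the \<open>i\<close>-th prime in a
  neighbour product counts the neighbours in class \<open>i\<close>.\<close>

lemma card_neighbour_class_eq:
  assumes V: "finite V" and i: "i < 5"
    and eq: "neighbour_product V E prime_label u = neighbour_product V E prime_label v"
  shows "card {w \<in> neighbours V E u. w mod 5 = i} = card {w \<in> neighbours V E v. w mod 5 = i}"
proof -
  have "multiplicity ([2, 3, 5, 7, 11] ! i) (neighbour_product V E prime_label x)
      = card {w \<in> neighbours V E x. w mod 5 = i}" for x
  proof -
    have fin: "finite (neighbours V E x)" using V by (simp add: neighbours_def)
    have "multiplicity ([2, 3, 5, 7, 11] ! i) (neighbour_product V E prime_label x)
        = (\<Sum>w\<in>neighbours V E x. multiplicity ([2, 3, 5, 7, 11] ! i) (prime_label w))"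
      unfolding neighbour_product_def
    proof (rule prime_elem_multiplicity_prod_distrib)
      show "0 \<notin> prime_label ` neighbours V E x"
        using prime_label_in_range by (metis atLeastAtMost_iff imageE not_one_le_zero)
    qed (use fin prime_nth_first_primes[OF i] in auto)
    also have "\<dots> = card {w \<in> neighbours V E x. w mod 5 = i}"
      using fin i by (simp add: multiplicity_prime_label sum.If_cases Int_def)
    finally show ?thesis .
  qed
  then show ?thesis using eq by metis
qed

lemma card_residue_class_ge:
  assumes "i < 5"
  shows "n div 5 \<le> card {w::nat. w < n \<and> w mod 5 = i}"
proof -
  have "n div 5 = card ((\<lambda>t. 5 * t + i) ` {..<n div 5})"
    by (subst card_image) (auto simp: inj_on_def)
  also have "\<dots> \<le> card {w. w < n \<and> w mod 5 = i}"
    using assms by (intro card_mono) auto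
  finally show ?thesis .
qed

section \<open>The probability that a given edge is bad\<close>

text \<open>The blocks are the possible edges from \<open>u\<close> to the five residue classes,
  with \<open>u\<close> and \<open>v\<close> left out. No block contains an edge at
  \<open>v\<close>, so the counts at \<open>v\<close> are legitimate targets.\<close>

lemma prob_equal_neighbour_products_le:
  assumes p: "0 < p" "p < 1" and n: "30 \<le> n" and uv: "u < n" "v < n" "u \<noteq> v"
  shows "measure_pmf.prob (Pi_pmf (vertex_pairs {..<n}) False (\<lambda>_. bernoulli_pmf p))
      {b. b {u, v} \<and> neighbour_product {..<n} {e \<in> vertex_pairs {..<n}. b e} prime_label u
                 = neighbour_product {..<n} {e \<in> vertex_pairs {..<n}. b e} prime_label v}
      \<le> (4 / sqrt (real n / 10 * (p * (1 - p)))) ^ 5"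
proof -
  define I where "I = vertex_pairs {..<n}"
  define N where "N = (\<lambda>b x i. {w \<in> neighbours {..<n} {e \<in> I. b e} x. w mod 5 = i})"
  define S where "S = (\<lambda>i. {w. w < n \<and> w mod 5 = i} - {u, v})"
  define J where "J = (\<lambda>i. (\<lambda>w. {w, u}) ` S i)"
  \<comment> \<open>The contribution of \<open>v\<close> itself to the count at \<open>u\<close>
    when \<open>uv\<close> is an edge.\<close>
  define d where "d = (\<lambda>i. if v mod 5 = i then 1 else 0 :: nat)"
  have pair_I: "{x, y} \<in> I \<longleftrightarrow> x < n \<and> y < n \<and> x \<noteq> y" for x y
    by (auto simp: I_def vertex_pairs_def card_2_iff doubleton_eq_iff)
  have inj: "inj_on (\<lambda>w. {w, u}) A" for A by (auto simp: inj_on_def doubleton_eq_iff)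
  have finI: "finite I"
    unfolding I_def vertex_pairs_def by (rule finite_subset[of _ "Pow {..<n}"]) auto
  have bound: "pmf (binomial_pmf (card (J i)) p) c \<le> 4 / sqrt (real n / 10 * (p * (1 - p)))"
    if "i < 5" for i c
  proof -
    \<comment> \<open>For \<open>n \<ge> 30\<close>, \<open>n div 5 - 2\<close> is at least
      \<open>n / 10\<close>.\<close>
    have "n div 5 - 2 \<le> card {w. w < n \<and> w mod 5 = i} - card {u, v}"
      using card_residue_class_ge[OF that, of n] uv by simp
    also have "\<dots> \<le> card (S i)" unfolding S_def by (rule diff_card_le_card_Diff) simp
    finally have "n div 5 - 2 \<le> card (J i)" unfolding J_def by (simp add: card_image[OF inj])
    then have ge: "real n / 10 \<le> real (card (J i))" using n by linarith
    then have "card (J i) > 0" using n by (cases "card (J i)") auto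
    then have "pmf (binomial_pmf (card (J i)) p) c \<le> 4 / sqrt (real (card (J i)) * (p * (1 - p)))"
      by (rule pmf_binomial_le[OF p])
    also have "\<dots> \<le> 4 / sqrt (real n / 10 * (p * (1 - p)))"
      using ge p n by (intro divide_left_mono real_sqrt_le_mono mult_right_mono mult_pos_pos) auto
    finally show ?thesis .
  qed
  have card_N: "card (N b u i) = card {e \<in> J i. b e} + d i" if "b {u, v}" for b i
  proof -
    let ?A = "{w \<in> S i. b {w, u}}"
    have "{e \<in> J i. b e} = (\<lambda>w. {w, u}) ` ?A" by (auto simp: J_def)
    then have "card {e \<in> J i. b e} = card ?A" by (simp add: card_image[OF inj])
    moreover have "N b u i = ?A \<union> (if v mod 5 = i then {v} else {})"
      using that uv by (auto simp: N_def S_def neighbours_def pair_I insert_commute)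
    moreover have "finite ?A" "v \<notin> ?A" by (auto simp: S_def)
    ultimately show ?thesis by (simp add: d_def)
  qed
  \<comment> \<open>The condition \<open>b {u, v}\<close> is dropped after use. On the original
    event the subtraction is exact, because there \<open>card (N b v i)\<close> equals the block
    count plus \<open>d i\<close>.\<close>
  have "measure_pmf.prob (Pi_pmf I False (\<lambda>_. bernoulli_pmf p))
      {b. b {u, v} \<and> neighbour_product {..<n} {e \<in> I. b e} prime_label u
                 = neighbour_product {..<n} {e \<in> I. b e} prime_label v}
    \<le> measure_pmf.prob (Pi_pmf I False (\<lambda>_. bernoulli_pmf p))
      {b. \<forall>i\<in>{..<5}. card {e \<in> J i. b e} = card (N b v i) - d i}"
  proof (rule measure_pmf.finite_measure_mono, safe)
    fix b i
    assume b: "b {u, v}" and i: "i < (5::nat)"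
      and eq: "neighbour_product {..<n} {e \<in> I. b e} prime_label u
             = neighbour_product {..<n} {e \<in> I. b e} prime_label v"
    have "card (N b u i) = card (N b v i)"
      unfolding N_def by (rule card_neighbour_class_eq[OF _ i eq]) simp
    then show "card {e \<in> J i. b e} = card (N b v i) - d i" using card_N[of b i] b by simp
  qed simp
  also have "\<dots> \<le> (4 / sqrt (real n / 10 * (p * (1 - p)))) ^ card {..<5::nat}"
  proof (rule prob_Pi_pmf_cards_eq_le[OF finI])
    show "J i \<subseteq> I" for i using uv by (auto simp: J_def S_def pair_I)
    show "disjoint_family_on J {..<5}"
      by (auto simp: disjoint_family_on_def J_def S_def doubleton_eq_iff)
    show "card (N b v i) - d i = card (N b' v i) - d i"
      if "\<And>e. e \<notin> (\<Union>j\<in>{..<5}. J j) \<Longrightarrow> b e = b' e" for b b' i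
    proof -
      \<comment> \<open>A block edge joins \<open>u\<close> to a vertex other than \<open>v\<close>,
        so \<open>{w, v}\<close> is never one, not even for \<open>w = u\<close>.\<close>
      have "b {w, v} = b' {w, v}" for w
        using uv by (intro that) (auto simp: J_def S_def doubleton_eq_iff)
      then have "N b v i = N b' v i" by (auto simp: N_def neighbours_def)
      then show ?thesis by simp
    qed
  qed (use p bound in auto)
  finally show ?thesis by (simp add: I_def)
qed

section \<open>Union bound and limit\<close>

lemma prob_product_labeling_ge:
  assumes p: "0 < p" "p < 1" and n: "30 \<le> n"
  shows "measure_pmf.prob (random_graph n p) {E. \<exists>f. product_labeling 11 {..<n} E f}
      \<ge> 1 - (real n)\<^sup>2 * (4 / sqrt (real n / 10 * (p * (1 - p)))) ^ 5"
proof -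
  define I where "I = vertex_pairs {..<n}"
  define G where "G = (\<lambda>b. {e \<in> I. b e})"
  define Q where "Q = Pi_pmf I False (\<lambda>_. bernoulli_pmf p)"
  define M where "M = (4 / sqrt (real n / 10 * (p * (1 - p)))) ^ 5"
  \<comment> \<open>The clause \<open>u \<noteq> v\<close> makes the diagonal events empty, so the
    union can run over all \<open>n^2\<close> ordered pairs.\<close>
  define A where "A = (\<lambda>(u, v). {b. b {u, v} \<and> u \<noteq> v \<and> neighbour_product {..<n} (G b) prime_label u
                 = neighbour_product {..<n} (G b) prime_label v})"
  have bad: "measure_pmf.prob Q (A (u, v)) \<le> M" if "u < n" "v < n" for u v
  proof (cases "u = v")
    case True
    then show ?thesis using p by (simp add: A_def M_def)
  next
    case False
    then show ?thesis
      using prob_equal_neighbour_products_le[OF p n that False]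
      by (simp add: A_def M_def Q_def G_def I_def)
  qed
  have "1 - measure_pmf.prob Q {b. \<exists>f. product_labeling 11 {..<n} (G b) f}
      = measure_pmf.prob Q (- {b. \<exists>f. product_labeling 11 {..<n} (G b) f})"
    by (simp add: measure_pmf.prob_compl[symmetric] Compl_eq_Diff_UNIV)
  also have "\<dots> \<le> measure_pmf.prob Q (\<Union>x\<in>{..<n} \<times> {..<n}. A x)"
  proof (rule measure_pmf.finite_measure_mono)
    show "- {b. \<exists>f. product_labeling 11 {..<n} (G b) f} \<subseteq> (\<Union>x\<in>{..<n} \<times> {..<n}. A x)"
    proof
      fix b assume "b \<in> - {b. \<exists>f. product_labeling 11 {..<n} (G b) f}"
      then have "\<not> product_labeling 11 {..<n} (G b) prime_label" by blast
      then obtain u v where "u < n" "v < n" and e: "{u, v} \<in> G b"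
        and "neighbour_product {..<n} (G b) prime_label u = neighbour_product {..<n} (G b) prime_label v"
        unfolding product_labeling_def using prime_label_in_range by auto
      moreover from e have "b {u, v}" "u \<noteq> v"
        by (auto simp: G_def I_def vertex_pairs_def)
      ultimately show "b \<in> (\<Union>x\<in>{..<n} \<times> {..<n}. A x)" by (auto simp: A_def)
    qed
  qed simp
  also have "\<dots> \<le> (\<Sum>x\<in>{..<n} \<times> {..<n}. measure_pmf.prob Q (A x))"
    by (rule measure_pmf.finite_measure_subadditive_finite) auto
  also have "\<dots> \<le> (\<Sum>x\<in>{..<n} \<times> {..<n}. M)"
    using bad by (intro sum_mono) auto
  also have "\<dots> = (real n)\<^sup>2 * M" by (simp add: power2_eq_square)
  finally have "1 - (real n)\<^sup>2 * M \<le> measure_pmf.prob Q {b. \<exists>f. product_labeling 11 {..<n} (G b) f}"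
    by simp
  moreover have "random_graph n p = map_pmf G Q"
    by (simp add: random_graph_def G_def Q_def I_def)
  ultimately show ?thesis by (simp add: M_def vimage_def)
qed

theorem theorem4:
  fixes p :: real
  assumes "0 < p" and "p < 1"
  shows "(\<lambda>n. measure_pmf.prob (random_graph n p)
            {E. \<exists>f. product_labeling 11 {..<n} E f}) \<longlonglongrightarrow> 1"
proof (rule tendsto_sandwich)
  show "\<forall>\<^sub>F n in sequentially. 1 - (real n)\<^sup>2 * (4 / sqrt (real n / 10 * (p * (1 - p)))) ^ 5
      \<le> measure_pmf.prob (random_graph n p) {E. \<exists>f. product_labeling 11 {..<n} E f}"
    using eventually_ge_at_top[of 30]
    by eventually_elim (rule prob_product_labeling_ge[OF assms])
  \<comment> \<open>With \<open>c\<close> a positive constant, the error is a constant times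
    \<open>n^(2 - 5/2)\<close>. Five classes are what make this bound vanish: four would only leave
    it bounded.\<close>
  define c where "c = p * (1 - p)"
  have c: "c > 0" using assms by (simp add: c_def)
  show "(\<lambda>n. 1 - (real n)\<^sup>2 * (4 / sqrt (real n / 10 * (p * (1 - p)))) ^ 5) \<longlonglongrightarrow> 1"
    using c unfolding c_def[symmetric] by real_asymp
qed auto

end
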